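(* Let $f(x),g(x)\in\mathbb{Z}[x]$ be polynomials of positive degree having no common complex root, let $m=\deg(f)$, $n=\deg(g)$, and $d=\gcd(L(f),L(g))$. Then $$R(f,g)\mid d^{m+n-1}\,B(f,g)^{\max(m,n)}.$$ Moreover, if both $f$ and $g$ are monic, then $R(f,g)\mid B(f,g)^{\min(m,n)}$.
   Context: $L(h)$ denotes the leading coefficient of $h\in\mathbb{Z}[x]$. There are unique $p,q\in\mathbb{Q}[x]$ with $pf+qg=1$, $\deg p<\deg g$, $\deg q<\deg f$; $B(f,g)$ is the least common multiple of the denominators (in lowest terms) of all coefficients of these $p$ and $q$. $R(f,g)=|\mathrm{Res}(f,g)|$, the absolute value of the resultant of $f$ and $g$. *)

theory Defs
  imports
    Complex_Main
    "HOL-Computational_Algebra.Fundamental_Theorem_Algebra"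
    "HOL-Computational_Algebra.Field_as_Ring"
    "Subresultants.Resultant_Prelim"
begin

definition is_bezout_pair ::
    "int poly \<Rightarrow> int poly \<Rightarrow> rat poly \<times> rat poly \<Rightarrow> bool" where
  "is_bezout_pair f g pq \<longleftrightarrow>
     fst pq * of_int_poly f + snd pq * of_int_poly g = 1 \<and>
     degree (fst pq) < degree g \<and> degree (snd pq) < degree f"

definition bezout_pair :: "int poly \<Rightarrow> int poly \<Rightarrow> rat poly \<times> rat poly" where
  "bezout_pair f g = (THE pq. is_bezout_pair f g pq)"

definition rat_denominator :: "rat \<Rightarrow> int" where
  "rat_denominator r = snd (quotient_of r)"

(* The list coeffs omits only the zero coefficients beyond the degree, whose denominator is 1. *)
definition bezout_denominator :: "int poly \<Rightarrow> int poly \<Rightarrow> int" where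
  "bezout_denominator f g =
     Lcm (rat_denominator `
       (set (coeffs (fst (bezout_pair f g))) \<union> set (coeffs (snd (bezout_pair f g)))))"

definition abs_resultant :: "int poly \<Rightarrow> int poly \<Rightarrow> int" where
  "abs_resultant f g = \<bar>resultant f g\<bar>"

lemma coprime_rat_if_no_common_root:
  fixes f g :: "int poly"
  assumes f0: "degree f > 0"
    and nr: "\<not> (\<exists>z::complex. poly (of_int_poly f) z = 0 \<and> poly (of_int_poly g) z = 0)"
  shows "coprime (of_int_poly f :: rat poly) (of_int_poly g)"
proof (rule ccontr)
  let ?F = "of_int_poly f :: rat poly" and ?G = "of_int_poly g :: rat poly"
  interpret R: map_poly_comm_ring_hom "of_rat :: rat \<Rightarrow> complex"
    by unfold_locales (auto simp: of_rat_add of_rat_mult)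
  let ?c = "map_poly (of_rat :: rat \<Rightarrow> complex)"
  define h where "h = gcd ?F ?G"
  assume "\<not> coprime ?F ?G"
  then have nu: "\<not> is_unit h" unfolding h_def by (simp only: is_unit_gcd not_False_eq_True simp_thms)
  have "f \<noteq> 0" using f0 by auto
  then have h0: "h \<noteq> 0" unfolding h_def by simp
  have "degree h > 0" using nu h0 is_unit_iff_degree[of h] by simp
  then have "degree (?c h) > 0" by (simp add: degree_map_poly)
  then obtain z where z: "poly (?c h) z = 0"
    using fundamental_theorem_of_algebra[of "?c h"] by (auto simp: constant_degree)
  have cc: "?c (of_int_poly k) = of_int_poly k" for k :: "int poly"
    by (simp add: map_poly_map_poly o_def)
  have "?c h dvd ?c ?F" "?c h dvd ?c ?G"
    unfolding h_def by (auto intro!: R.hom_dvd)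
  then have "poly (of_int_poly f) z = 0 \<and> poly (of_int_poly g) z = 0"
    unfolding cc using z by (auto elim!: dvdE)
  with nr show False by blast
qed

lemma ex1_bezout_pair:
  fixes f g :: "int poly"
  assumes f0: "degree f > 0" and g0: "degree g > 0"
    and nr: "\<not> (\<exists>z::complex. poly (of_int_poly f) z = 0 \<and> poly (of_int_poly g) z = 0)"
  shows "\<exists>!pq. is_bezout_pair f g pq"
proof -
  let ?F = "of_int_poly f :: rat poly" and ?G = "of_int_poly g :: rat poly"
  have dF: "degree ?F = degree f" and dG: "degree ?G = degree g"
    by (simp_all add: degree_map_poly)
  have F0: "?F \<noteq> 0" and G0: "?G \<noteq> 0" using f0 g0 dF dG by auto
  have co: "coprime ?F ?G" by (rule coprime_rat_if_no_common_root[OF f0 nr])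
  obtain a b where ab: "a * ?F + b * ?G = 1"
    using bezout_coefficients[of ?F ?G] co by (metis coprime_imp_gcd_eq_1 prod.exhaust)
  define p where "p = a mod ?G"
  define q where "q = b + (a div ?G) * ?F"
  have a: "a = a div ?G * ?G + p" unfolding p_def by (rule div_mult_mod_eq[symmetric])
  have "1 = (a div ?G * ?G + p) * ?F + b * ?G" using ab by (simp add: a[symmetric])
  then have pq: "p * ?F + q * ?G = 1" unfolding q_def by (simp add: algebra_simps)
  have dp: "degree p < degree g"
    using degree_mod_less[OF G0, of a] g0 dG unfolding p_def by auto
  have dq: "degree q < degree f"
  proof (cases "q = 0")
    case False
    have "degree q + degree g = degree (q * ?G)" using False G0 dG by (simp add: degree_mult_eq)
    also have "q * ?G = 1 - p * ?F" using pq by (simp add: algebra_simps)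
    also have "degree \<dots> \<le> max (degree (1 :: rat poly)) (degree (p * ?F))"
      by (rule degree_diff_le_max)
    also have "\<dots> \<le> degree p + degree f" using degree_mult_le[of p ?F] dF by simp
    finally show ?thesis using dp by simp
  qed (use f0 in simp)
  show ?thesis
  proof (rule ex1I[of _ "(p, q)"])
    show "is_bezout_pair f g (p, q)" using pq dp dq by (simp add: is_bezout_pair_def)
    fix rs assume rs: "is_bezout_pair f g rs"
    obtain r s where rs_eq: "rs = (r, s)" by force
    have r: "r * ?F + s * ?G = 1" "degree r < degree g"
      using rs unfolding rs_eq is_bezout_pair_def by auto
    have eq: "(r - p) * ?F = (q - s) * ?G" using r(1) pq by (simp add: algebra_simps)
    then have "?G dvd (r - p) * ?F" by simp
    then have dv: "?G dvd r - p"
      using co by (simp add: coprime_dvd_mult_left_iff coprime_commute)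
    have "degree (r - p) < degree ?G" using r(2) dp dG by (simp add: degree_diff_less)
    with dv have "r - p = 0" using dvd_imp_degree_le[OF dv] by force
    with eq G0 show "rs = (p, q)" unfolding rs_eq by simp
  qed
qed

end

theory Submission
  imports Defs "Subresultants.Subresultant"
begin

text \<open>
  Clearing denominators gives integer polynomials with $P f + Q g = B$, where $B = B(f,g)$.
  At every complex root $\alpha$ of $f$ this reads $Q(\alpha) g(\alpha) = B$, so the product formula
  $\mathrm{Res}(f,h) = L(f)^{\deg h} \prod_\alpha h(\alpha)$ yields
  $\mathrm{Res}(f,Q) \, \mathrm{Res}(f,g) = L(f)^{\deg Q + n} B^m$ in the integers. As $\deg Q < m$,
  $R(f,g)$ divides $L(f)^{m+n-1} B^m$, and by symmetry also $L(g)^{m+n-1} B^n$.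
\<close>

text \<open>The resultant is the subresultant of index 0, and \<open>F mod G\<close> arises from
  \<open>F\<close> by adding a multiple of \<open>G\<close>, so the transformation rules for
  subresultants apply. If \<open>degree F < degree G\<close>, only the sign rule for swapping
  remains.\<close>

lemma resultant_mod:
  fixes F G :: "'a :: field poly"
  assumes "degree G > 0"
  shows "resultant F G = (- 1) ^ (degree F * degree G)
    * lead_coeff G ^ (degree F - degree (F mod G)) * resultant G (F mod G)"
proof (cases "degree F < degree G")
  case True
  then show ?thesis by (simp add: mod_poly_less resultant_swap[of F G])
next
  case False
  let ?H = "F mod G"
  have eq: "F + (- (F div G)) * G = ?H"
    by (simp add: minus_div_mult_eq_mod[symmetric])
  have le: "degree G \<le> degree F" using False by simp
  have lt: "degree ?H < degree G"
    using assms degree_mod_less[of G F] by (cases "?H = 0"; cases "G = 0") auto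
  show ?thesis
  proof (cases "degree ?H > 0")
    case True
    from BT_lemma_1_12[OF eq le disjI1[OF lt] True]
    show ?thesis by (simp add: subresultant_resultant)
  next
    \<comment> \<open>A constant remainder, possibly 0, has degree equal to the index 0, so the rule
      for index \<open>degree ?H\<close> replaces the one for smaller indices. It gives
      \<open>c ^ (degree G - 1)\<close> times the constant polynomial \<open>[:c:]\<close>, which
      supplies the missing factor.\<close>
    case False
    then have 0: "degree ?H = 0" by simp
    then obtain c where c: "?H = [:c:]" by (rule degree_eq_zeroE)
    have "subresultant 0 F G = Polynomial.smult ((- 1) ^ (degree F * degree G)
        * lead_coeff G ^ degree F * c ^ (degree G - 1)) [:c:]"
      using BT_lemma_1_13[OF eq le disjI1[OF lt] disjI1[OF lt]] by (simp add: c)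
    moreover have "c ^ degree G = c ^ (degree G - 1) * c"
      using assms by (metis power_minus_mult)
    ultimately show ?thesis by (simp add: c subresultant_resultant)
  qed
qed

lemma poly_eq_prod_proots:
  fixes p :: "complex poly"
  shows "poly p x = lead_coeff p * (\<Prod>r\<in>#proots p. x - r)"
proof -
  have "poly p x = poly (Polynomial.smult (lead_coeff p) (\<Prod>r\<in>#proots p. [:-r, 1:])) x"
    by (simp only: complex_poly_decompose_multiset)
  then show ?thesis by (simp add: poly_prod_mset image_mset.compositionality o_def)
qed

text \<open>Both sides expand to the leading coefficient powers times the product of all differences
  of a root of \<open>H\<close> and a root of \<open>G\<close>. Reversing all
  \<open>degree G * degree H\<close> differences produces the sign.\<close>

lemma prod_proots_swap:
  fixes G H :: "complex poly"
  shows "lead_coeff H ^ degree G * (\<Prod>r\<in>#proots H. poly G r)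
    = (- 1) ^ (degree G * degree H) * lead_coeff G ^ degree H * (\<Prod>a\<in>#proots G. poly H a)"
proof -
  have "(\<Prod>a\<in>#proots G. \<Prod>r\<in>#proots H. a - r)
      = (\<Prod>r\<in>#proots H. \<Prod>a\<in>#proots G. - 1 * (r - a))"
    by (subst prod_mset.swap) simp
  also have "\<dots> = (- 1) ^ (degree G * degree H) * (\<Prod>r\<in>#proots H. \<Prod>a\<in>#proots G. r - a)"
    by (simp only: prod_mset.distrib prod_mset_constant size_proots_complex power_mult)
  finally have "(\<Prod>r\<in>#proots H. \<Prod>a\<in>#proots G. r - a)
      = (- 1) ^ (degree G * degree H) * (\<Prod>a\<in>#proots G. \<Prod>r\<in>#proots H. a - r)"
    by (simp add: power_mult_distrib[symmetric] flip: mult.assoc)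
  then show ?thesis
    by (simp add: poly_eq_prod_proots[of G] poly_eq_prod_proots[of H] prod_mset.distrib size_proots_complex)
qed

text \<open>Euclidean descent: both sides change in the same way when \<open>(F, G)\<close> is replaced by \<open>(G, F mod G)\<close>.\<close>

lemma resultant_eq_prod_proots_right:
  fixes F G :: "complex poly"
  assumes "F \<noteq> 0" "G \<noteq> 0"
  shows "resultant F G = (- 1) ^ (degree F * degree G) * lead_coeff G ^ degree F
    * (\<Prod>a\<in>#proots G. poly F a)"
  using assms
proof (induction "degree G" arbitrary: F G rule: less_induct)
  case less
  show ?case
  proof (cases "degree G = 0")
    case True
    then obtain c where "G = [:c:]" by (rule degree_eq_zeroE)
    then show ?thesis by simp
  next
    case False
    let ?H = "F mod G"
    note mod = resultant_mod[of G F]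
    have H: "poly ?H a = poly F a" if "a \<in># proots G" for a
      using that less.prems by (simp add: poly_mod)
    have prod_H: "(\<Prod>a\<in>#proots G. poly ?H a) = (\<Prod>a\<in>#proots G. poly F a)"
      using H by (intro arg_cong[of _ _ prod_mset] image_mset_cong)
    show ?thesis
    proof (cases "?H = 0")
      case True
      \<comment> \<open>Here \<open>G\<close> divides \<open>F\<close>, so a root of
        \<open>G\<close> contributes a factor 0 to the product, matching a vanishing
        resultant.\<close>
      have "proots G \<noteq> {#}" using False size_proots_complex[of G] by auto
      then have "(\<Prod>a\<in>#proots G. poly F a) = 0"
        unfolding prod_H[symmetric] using True by (auto simp: power_0_left)
      then show ?thesis using mod False True by simp
    next
      case nz: False
      have lt: "degree ?H < degree G"
        using nz less.prems(2) degree_mod_less[of G F] by auto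
      \<comment> \<open>Makes the natural number subtraction \<open>degree F - degree ?H\<close>
        exact, so that the powers of \<open>lead_coeff G\<close> combine to exponent
        \<open>degree F\<close>.\<close>
      have le: "degree ?H \<le> degree F"
        using lt by (cases "degree F < degree G") (auto simp: mod_poly_less)
      have "resultant G ?H = (- 1) ^ (degree G * degree ?H) * lead_coeff ?H ^ degree G
          * (\<Prod>r\<in>#proots ?H. poly G r)"
        using less.hyps[OF lt less.prems(2) nz] .
      \<comment> \<open>The swap moves the product to the roots of \<open>G\<close>, where
        \<open>?H\<close> and \<open>F\<close> agree; its sign cancels the one already
        present.\<close>
      also have "\<dots> = lead_coeff G ^ degree ?H * (\<Prod>a\<in>#proots G. poly F a)"
        using prod_proots_swap[of ?H G]
        by (simp add: prod_H mult.assoc flip: power_mult_distrib)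
      finally show ?thesis using mod False le
        by (simp add: mult.assoc) (simp flip: mult.assoc power_add)
    qed
  qed
qed

lemma resultant_eq_prod_proots_left:
  fixes F G :: "complex poly"
  assumes "F \<noteq> 0" "G \<noteq> 0"
  shows "resultant F G = lead_coeff F ^ degree G * (\<Prod>a\<in>#proots F. poly G a)"
  unfolding resultant_swap[of F G] resultant_eq_prod_proots_right[OF assms(2,1)]
  by (simp add: mult.commute[of "degree F"] flip: mult.assoc power_mult_distrib)

lemma of_int_poly_const: "of_int_poly [:c:] = [:of_int c:]"
  by (intro poly_eqI) (simp add: coeff_pCons split: nat.split)

text \<open>Stated for any integer relation with constant right-hand side, so that it also applies
  with the two polynomials exchanged.\<close>

lemma resultant_dvd_lead_coeff_power:
  fixes f g P Q :: "int poly" and B :: int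
  assumes bezout: "P * f + Q * g = [:B:]"
    and g: "g \<noteq> 0" and Q: "degree Q < degree f"
  shows "resultant f g dvd lead_coeff f ^ (degree f + degree g - 1) * B ^ degree f"
proof (cases "Q = 0")
  case True
  \<comment> \<open>A nonzero constant cannot be a multiple of the nonconstant \<open>f\<close>.
    Since \<open>degree f > 0\<close>, the power of \<open>B\<close> then vanishes as well.\<close>
  have "B = 0"
  proof (rule ccontr)
    assume "B \<noteq> 0"
    then have "P \<noteq> 0" "f \<noteq> 0" using bezout True by auto
    then have "degree (P * f) > 0" using Q by (simp add: degree_mult_eq)
    then show False using bezout True by simp
  qed
  then show ?thesis using Q by (simp add: power_0_left)
next
  case False
  let ?c = "of_int_poly :: int poly \<Rightarrow> complex poly"
  have f: "f \<noteq> 0" using Q by auto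
  have nz: "?c f \<noteq> 0" "?c g \<noteq> 0" "?c Q \<noteq> 0" using f g False by auto
  have "poly (?c Q) a * poly (?c g) a = of_int B" if "a \<in># proots (?c f)" for a
  proof -
    have "?c P * ?c f + ?c Q * ?c g = ?c [:B:]"
      unfolding bezout[symmetric] by (simp add: hom_distribs)
    then have "poly (?c P * ?c f + ?c Q * ?c g) a = of_int B" by (simp add: of_int_poly_const)
    then show ?thesis using that nz by simp
  qed
  then have "(\<Prod>a\<in>#proots (?c f). poly (?c Q) a * poly (?c g) a)
      = (\<Prod>a\<in>#proots (?c f). of_int B)"
    by (intro arg_cong[of _ _ prod_mset] image_mset_cong)
  then have prod: "(\<Prod>a\<in>#proots (?c f). poly (?c Q) a) * (\<Prod>a\<in>#proots (?c f). poly (?c g) a)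
      = of_int B ^ degree f"
    by (simp add: prod_mset.distrib size_proots_complex)
  \<comment> \<open>The product formula lives over the complex numbers, but both ends are images of
    integers, so the identity descends and gives divisibility.\<close>
  have "(of_int (resultant f Q * resultant f g) :: complex)
      = resultant (?c f) (?c Q) * resultant (?c f) (?c g)"
    by (simp add: of_int_hom.resultant_hom)
  also have "\<dots> = of_int (lead_coeff f ^ (degree Q + degree g) * B ^ degree f)"
    using nz by (simp add: resultant_eq_prod_proots_left power_add flip: prod)
  finally have "resultant f Q * resultant f g = lead_coeff f ^ (degree Q + degree g) * B ^ degree f"
    by (simp only: of_int_eq_iff)
  then have "resultant f g dvd lead_coeff f ^ (degree Q + degree g) * B ^ degree f"
    by (metis dvd_triv_right)
  also have "\<dots> dvd lead_coeff f ^ (degree f + degree g - 1) * B ^ degree f"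
    using Q by (intro mult_dvd_mono le_imp_power_dvd) auto
  finally show ?thesis .
qed

lemma smult_in_int_poly:
  fixes p :: "rat poly" and B :: int
  assumes "\<And>c. c \<in> set (coeffs p) \<Longrightarrow> rat_denominator c dvd B"
  obtains P where "of_int_poly P = Polynomial.smult (of_int B) p"
proof -
  have int: "of_int B * coeff p i \<in> \<int>" for i
  proof (cases "coeff p i = 0")
    case False
    then have "coeff p i \<in> set (coeffs p)"
      by (metis coeff_in_coeffs le_degree coeff_0)
    from assms[OF this] obtain k where k: "B = rat_denominator (coeff p i) * k" by (rule dvdE)
    obtain a b where ab: "quotient_of (coeff p i) = (a, b)" by force
    have "coeff p i = of_int a / of_int b" "b > 0"
      using quotient_of_div[OF ab] quotient_of_denom_pos[OF ab] by auto
    then have "of_int B * coeff p i = of_int (a * k)"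
      using k ab by (simp add: rat_denominator_def)
    then show ?thesis by (metis Ints_of_int)
  qed simp
  \<comment> \<open>All coefficients are already integers, so \<open>floor\<close> merely changes
    their type.\<close>
  have "of_int_poly (map_poly floor (Polynomial.smult (of_int B) p)) = Polynomial.smult (of_int B) p"
    using int by (intro poly_eqI) (simp add: coeff_map_poly)
  then show thesis by (rule that)
qed

lemma bezout_denominator_relation:
  fixes f g :: "int poly"
  assumes "degree f > 0" and "degree g > 0"
    and "\<not> (\<exists>z::complex. poly (of_int_poly f) z = 0 \<and> poly (of_int_poly g) z = 0)"
  obtains P Q where "P * f + Q * g = [:bezout_denominator f g:]"
    and "degree P < degree g" and "degree Q < degree f"
proof -
  define B where "B = bezout_denominator f g"
  obtain p q where pq: "bezout_pair f g = (p, q)" by force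
  have "is_bezout_pair f g (p, q)"
    using theI'[OF ex1_bezout_pair[OF assms]] by (simp add: bezout_pair_def flip: pq)
  then have eq: "p * of_int_poly f + q * of_int_poly g = 1"
    and deg: "degree p < degree g" "degree q < degree f"
    by (auto simp: is_bezout_pair_def)
  have "rat_denominator c dvd B" if "c \<in> set (coeffs p) \<union> set (coeffs q)" for c
    using that unfolding B_def bezout_denominator_def pq by (auto intro!: dvd_Lcm)
  then obtain P Q where P: "of_int_poly P = Polynomial.smult (of_int B) p"
    and Q: "of_int_poly Q = Polynomial.smult (of_int B) q"
    by (metis Un_iff smult_in_int_poly)
  have "(of_int_poly (P * f + Q * g) :: rat poly) = Polynomial.smult (of_int B) 1"
    by (simp add: hom_distribs P Q flip: eq smult_add_right)
  also have "\<dots> = of_int_poly [:B:]" by (simp add: of_int_poly_const)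
  finally have "P * f + Q * g = [:B:]" by (simp only: of_int_poly_hom.eq_iff)
  moreover have "degree P < degree g"
    using deg(1) degree_smult_le[of "of_int B" p] by (simp flip: P)
  moreover have "degree Q < degree f"
    using deg(2) degree_smult_le[of "of_int B" q] by (simp flip: Q)
  ultimately show thesis using that unfolding B_def by blast
qed

theorem theorem5p6:
  fixes f g :: "int poly" and m n :: nat and d :: int
  assumes "degree f > 0" and "degree g > 0"
    and "\<not> (\<exists>z::complex. poly (of_int_poly f) z = 0 \<and> poly (of_int_poly g) z = 0)"
    and "m = degree f" and "n = degree g"
    and "d = gcd (lead_coeff f) (lead_coeff g)"
  shows "abs_resultant f g dvd d ^ (m + n - 1) * bezout_denominator f g ^ max m n
    \<and> (monic f \<and> monic g \<longrightarrow> abs_resultant f g dvd bezout_denominator f g ^ min m n)"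
proof -
  define B where "B = bezout_denominator f g"
  define k where "k = m + n - 1"
  obtain P Q where PQ: "P * f + Q * g = [:B:]" "degree P < degree g" "degree Q < degree f"
    using bezout_denominator_relation[OF assms(1-3)] unfolding B_def .
  have QP: "Q * g + P * f = [:B:]" using PQ(1) by (simp add: add.commute)
  have nz: "f \<noteq> 0" "g \<noteq> 0" using assms(1,2) by auto
  have "resultant f g dvd lead_coeff f ^ k * B ^ m"
    using resultant_dvd_lead_coeff_power[OF PQ(1) nz(2) PQ(3)] assms(4,5) by (simp add: k_def)
  then have f: "abs_resultant f g dvd lead_coeff f ^ k * B ^ m"
    by (simp add: abs_resultant_def)
  have "abs_resultant f g = \<bar>resultant g f\<bar>"
    unfolding abs_resultant_def resultant_swap[of f g] by (simp add: abs_mult power_abs)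
  moreover have "resultant g f dvd lead_coeff g ^ k * B ^ n"
    using resultant_dvd_lead_coeff_power[OF QP nz(1) PQ(2)] assms(4,5)
    by (simp add: k_def add.commute)
  ultimately have g: "abs_resultant f g dvd lead_coeff g ^ k * B ^ n" by simp
  \<comment> \<open>Raising both powers of \<open>B\<close> to the larger exponent gives the two
    bounds a common factor. The gcd then reduces to that of the leading coefficient powers, which is
    \<open>d ^ k\<close>.\<close>
  let ?M = "B ^ max m n"
  have "abs_resultant f g dvd lead_coeff f ^ k * ?M"
    by (rule dvd_trans[OF f]) (intro mult_dvd_mono le_imp_power_dvd; simp)
  moreover have "abs_resultant f g dvd lead_coeff g ^ k * ?M"
    by (rule dvd_trans[OF g]) (intro mult_dvd_mono le_imp_power_dvd; simp)
  ultimately have "abs_resultant f g dvd gcd (lead_coeff f ^ k * ?M) (lead_coeff g ^ k * ?M)"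
    by simp
  also have "\<dots> = normalize (d ^ k * ?M)"
    by (simp only: gcd_mult_right gcd_exp assms(6) gcd.commute)
  finally have "abs_resultant f g dvd d ^ k * ?M" by simp
  \<comment> \<open>With leading coefficients 1 the bounds are \<open>B ^ m\<close> and
    \<open>B ^ n\<close> themselves, and the smaller exponent may be chosen.\<close>
  moreover have "abs_resultant f g dvd B ^ min m n" if "monic f \<and> monic g"
    using f g that by (auto simp: min_def)
  ultimately show ?thesis unfolding B_def k_def by blast
qed

end
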